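(* Let $X$ be a finite rack with connected components $C_1,\dots,C_k$. There exists $N$ (depending on $X$) such that the following holds. Let $s=(x_1,\dots,x_n)\in X^n$ with $\langle x_1,\dots,x_n\rangle=X$, let $D_j=\{1\le i\le n: x_i\in C_j\}$ and $n_j=|D_j|$, and suppose $n_1,\dots,n_k\ge N$. Then the image in $S_n$ of the stabilizer of $s$ in $B_n$ contains $A_{n_1}\times\dots\times A_{n_k}$.
   Context: A rack is a set $X$ with an operation $x^y$ such that $x\mapsto x^y$ is bijective for each $y$ and $(z^x)^y=(z^y)^{x^y}$; its connected components are the classes of the smallest equivalence relation with $x\sim x^y$; $\langle x_1,\dots,x_n\rangle=X$ means no proper subset of $X$ closed under the operation contains all $x_i$. $B_n$ acts on $X^n$ from the right by $(\dots,x_i,x_{i+1},\dots)^{\sigma_i}=(\dots,x_{i+1},x_i^{x_{i+1}},\dots)$, and $B_n\to S_n$ sends $\sigma_i\mapsto(i\ i+1)$. $S_{n_1}\times\dots\times S_{n_k}$ is identified with the permutations $\sigma\in S_n$ with $\sigma(D_j)=D_j$ for all $j$, and $A_{n_j}$ with the even permutations of $D_j$. *)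

theory Defs
  imports "HOL-Combinatorics.Combinatorics"
begin

text \<open>A rack on the carrier X with operation op, where op x y stands for x^y.\<close>
definition rack :: "'a set \<Rightarrow> ('a \<Rightarrow> 'a \<Rightarrow> 'a) \<Rightarrow> bool" where
  "rack X op \<longleftrightarrow>
     (\<forall>x\<in>X. \<forall>y\<in>X. op x y \<in> X) \<and>
     (\<forall>y\<in>X. bij_betw (\<lambda>x. op x y) X X) \<and>
     (\<forall>x\<in>X. \<forall>y\<in>X. \<forall>z\<in>X. op (op z x) y = op (op z y) (op x y))"

definition rack_conn :: "'a set \<Rightarrow> ('a \<Rightarrow> 'a \<Rightarrow> 'a) \<Rightarrow> ('a \<times> 'a) set" where
  "rack_conn X op =
     (let R = {(x, op x y) | x y. x \<in> X \<and> y \<in> X} in (R \<union> R\<inverse>)\<^sup>* \<inter> (X \<times> X))"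

definition rack_components :: "'a set \<Rightarrow> ('a \<Rightarrow> 'a \<Rightarrow> 'a) \<Rightarrow> 'a set set" where
  "rack_components X op = X // rack_conn X op"

definition rack_generates :: "'a set \<Rightarrow> ('a \<Rightarrow> 'a \<Rightarrow> 'a) \<Rightarrow> 'a list \<Rightarrow> bool" where
  "rack_generates X op s \<longleftrightarrow>
     (\<forall>Y. Y \<subseteq> X \<and> (\<forall>a\<in>Y. \<forall>b\<in>Y. op a b \<in> Y) \<and> set s \<subseteq> Y \<longrightarrow> Y = X)"

text \<open>Braid words: a letter (i, True) is sigma_i, (i, False) is sigma_i inverse
  (positions are 0-based, so sigma_i swaps positions i and i+1).
  A word is valid for B_n if all letters satisfy i + 1 < n.\<close>
definition braid_word :: "nat \<Rightarrow> (nat \<times> bool) list \<Rightarrow> bool" where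
  "braid_word n w \<longleftrightarrow> (\<forall>(i, e) \<in> set w. Suc i < n)"

definition braid_letter_act ::
  "'a set \<Rightarrow> ('a \<Rightarrow> 'a \<Rightarrow> 'a) \<Rightarrow> 'a list \<Rightarrow> nat \<times> bool \<Rightarrow> 'a list" where
  "braid_letter_act X op s l =
     (case l of (i, True) \<Rightarrow> s[i := s ! Suc i, Suc i := op (s ! i) (s ! Suc i)]
              | (i, False) \<Rightarrow>
                   s[i := the_inv_into X (\<lambda>x. op x (s ! i)) (s ! Suc i), Suc i := s ! i])"

definition braid_act ::
  "'a set \<Rightarrow> ('a \<Rightarrow> 'a \<Rightarrow> 'a) \<Rightarrow> 'a list \<Rightarrow> (nat \<times> bool) list \<Rightarrow> 'a list" where
  "braid_act X op s w = foldl (braid_letter_act X op) s w"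

definition braid_perm :: "(nat \<times> bool) list \<Rightarrow> nat \<Rightarrow> nat" where
  "braid_perm w = foldl (\<lambda>p (i, e). p \<circ> transpose i (Suc i)) id w"

end

(*
  Attach to every entry of s the name of its strand, and ask which renamings of the strands
  are realised by braid moves. If three strands carry the same label x, moving two of them
  next to the third reduces to (x, x, x), where pure braids correct the effect of the
  two-crossing braid, so their 3-cycle is realised.
  Choose e such that the e-th power of x |-> x^z is the identity for all z. A block of e strands
  labelled x commutes with every other strand, and pulling it around a strand labelled z
  turns it into a block labelled x^z without changing any other label. As the labels
  generate X, the block can take any label in the component of x. By pigeonhole each
  component has a label x that occurs more than e times; giving a block of x the label of
  an arbitrary strand i of the component yields the 3-cycles (i b c) for two fixed strands
  b, c of the block, and these generate the alternating group.
*)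
theory Submission
  imports Defs
begin

section \<open>Maps and invariants of equivalence closures\<close>

lemma equivclp_map:
  assumes "equivclp r x y" "\<And>x y. r x y \<Longrightarrow> r' (f x) (f y)"
  shows "equivclp r' (f x) (f y)"
  using assms(1)
proof induction
  case (step y z)
  from step.hyps(2) have "equivclp r' (f y) (f z)"
    using assms(2) by (auto intro: r_into_equivclp equivclp_sym)
  with step.IH show ?case
    by (rule equivclp_trans)
qed simp

lemma equivclp_invariant:
  assumes "equivclp r x y" "\<And>x y. r x y \<Longrightarrow> f x = f y"
  shows "f x = f y"
  using assms(1) by induction (use assms(2) in auto)

section \<open>Finite racks: translations, periods and components\<close>

locale finite_rack =
  fixes X :: "'a set" and op :: "'a \<Rightarrow> 'a \<Rightarrow> 'a"
  assumes rack: "rack X op" and finite: "finite X"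
begin

lemma op_closed [simp]: "x \<in> X \<Longrightarrow> y \<in> X \<Longrightarrow> op x y \<in> X"
  by (rule rack[unfolded rack_def, THEN conjunct1, THEN bspec, THEN bspec])

lemma bij_op: "y \<in> X \<Longrightarrow> bij_betw (\<lambda>x. op x y) X X"
  by (rule rack[unfolded rack_def, THEN conjunct2, THEN conjunct1, THEN bspec])

lemma op_distrib: "x \<in> X \<Longrightarrow> y \<in> X \<Longrightarrow> z \<in> X \<Longrightarrow> op (op z x) y = op (op z y) (op x y)"
  by (rule rack[unfolded rack_def, THEN conjunct2, THEN conjunct2, THEN bspec, THEN bspec, THEN bspec])

lemma op_surj:
  assumes "z \<in> X" "y \<in> X"
  obtains x where "x \<in> X" "op x y = z"
proof -
  have "z \<in> (\<lambda>x. op x y) ` X"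
    using bij_betw_imp_surj_on[OF bij_op[OF assms(2)]] assms(1) by simp
  then show ?thesis
    by (rule imageE) (rule that, simp_all)
qed

text \<open>Write w as v^x; self-distributivity then turns (v^x)^x into (v^x)^(x^x). In a rack x^x
  may differ from x, but the two act identically.\<close>

lemma op_op_self:
  assumes "w \<in> X" "x \<in> X"
  shows "op w (op x x) = op w x"
proof -
  obtain v where "v \<in> X" "op v x = w"
    using op_surj[OF assms] .
  then show ?thesis
    using op_distrib[of x x v] assms by auto
qed

text \<open>Each translation permutes the finite set X and so has finite order; a common multiple of
  these orders serves all of them.\<close>

lemma common_period:
  obtains e where "2 \<le> e" "\<And>x y. x \<in> X \<Longrightarrow> y \<in> X \<Longrightarrow> ((\<lambda>v. op v x) ^^ e) y = y"
proof -
  define P where "P x n \<longleftrightarrow> n > 0 \<and> (\<forall>y\<in>X. ((\<lambda>v. op v x) ^^ n) y = y)" for x and n :: nat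
  have "\<exists>n. P x n" if x: "x \<in> X" for x
  proof -
    \<comment> \<open>Extended by the identity outside X, the translation becomes a permutation of
      the whole type, to which nilpotency of finite permutations applies.\<close>
    define p where "p v = (if v \<in> X then op v x else v)" for v
    have "bij_betw p X X"
      using bij_op[OF x] by (rule bij_betw_cong[THEN iffD1, rotated]) (simp add: p_def)
    then have "p permutes X"
      by (rule bij_imp_permutes) (simp add: p_def)
    then have "permutation p"
      using finite permutation_permutes by blast
    then obtain n where n: "p ^^ n = id" "n > 0"
      by (rule permutation_is_nilpotent)
    have "((\<lambda>v. op v x) ^^ m) y = (p ^^ m) y \<and> (p ^^ m) y \<in> X" if "y \<in> X" for y m
      using that x by (induction m) (auto simp: p_def)
    then show ?thesis
      using n by (auto simp: P_def)
  qed
  then obtain f where f: "\<And>x. x \<in> X \<Longrightarrow> P x (f x)"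
    by metis
  \<comment> \<open>The factor 2 ensures \<open>2 \<le> e\<close>, so that a block of e strands
    contains two strands to be used as b and c.\<close>
  define e where "e = 2 * (\<Prod>x\<in>X. f x)"
  have "(\<Prod>x\<in>X. f x) > 0"
    using f by (intro prod_pos) (auto simp: P_def)
  then have "2 \<le> e"
    by (simp add: e_def)
  moreover have "((\<lambda>v. op v x) ^^ e) y = y" if "x \<in> X" "y \<in> X" for x y
  proof -
    have "f x dvd e"
      unfolding e_def using finite that by (intro dvd_mult dvd_prodI) auto
    then obtain k where k: "e = f x * k" ..
    have "((\<lambda>v. op v x) ^^ (f x * k)) y = y"
      using f[OF that(1)] that(2) by (induction k) (auto simp: P_def funpow_add)
    with k show ?thesis by simp
  qed
  ultimately show ?thesis
    using that by blast
qed

lemma equiv_rack_conn: "equiv X (rack_conn X op)"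
proof (rule equivI)
  show "sym (rack_conn X op)"
    unfolding rack_conn_def Let_def
    by (intro sym_Int sym_rtrancl sym_Un_converse) (auto simp: sym_def)
  show "trans (rack_conn X op)"
    unfolding rack_conn_def Let_def
    by (intro trans_Int trans_rtrancl) (auto simp: trans_def)
qed (auto simp: rack_conn_def Let_def refl_on_def)

lemma rack_conn_op: "x \<in> X \<Longrightarrow> y \<in> X \<Longrightarrow> (x, op x y) \<in> rack_conn X op"
  by (auto simp: rack_conn_def Let_def intro!: r_into_rtrancl)

lemma rack_conn_invariant:
  assumes "(x, y) \<in> rack_conn X op"
    and op: "\<And>v z. v \<in> X \<Longrightarrow> z \<in> X \<Longrightarrow> Q v \<longleftrightarrow> Q (op v z)"
  shows "Q x \<longleftrightarrow> Q y"
proof -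
  let ?R = "{(x, op x y) | x y. x \<in> X \<and> y \<in> X}"
  have "(x, y) \<in> (?R \<union> ?R\<inverse>)\<^sup>*"
    using assms(1) by (simp add: rack_conn_def Let_def)
  then show ?thesis
  proof induction
    case (step y z)
    then have "Q y \<longleftrightarrow> Q z"
      using op by auto
    with step.IH show ?case by simp
  qed simp
qed

section \<open>Braid moves on named strands and their invariants\<close>

text \<open>The second components name the strands. The strands move with their labels, so the braid
  permutation can be read off the result.\<close>

inductive braid_step :: "('a \<times> 'b) list \<Rightarrow> ('a \<times> 'b) list \<Rightarrow> bool" where
  "x \<in> X \<Longrightarrow> y \<in> X \<Longrightarrow>
    braid_step (A @ (x, a) # (y, b) # B) (A @ (y, b) # (op x y, a) # B)"

abbreviation braid_equiv :: "('a \<times> 'b) list \<Rightarrow> ('a \<times> 'b) list \<Rightarrow> bool" (infix "\<approx>" 50) where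
  "u \<approx> v \<equiv> equivclp braid_step u v"

lemma braid_equiv_swap:
  "x \<in> X \<Longrightarrow> y \<in> X \<Longrightarrow> A @ (x, a) # (y, b) # B \<approx> A @ (y, b) # (op x y, a) # B"
  by (intro r_into_equivclp braid_step.intros)

lemma braid_equiv_context: "u \<approx> v \<Longrightarrow> A @ u @ B \<approx> A @ v @ B"
proof (erule equivclp_map)
  fix u v :: "('a \<times> 'b) list"
  assume "braid_step u v"
  then show "braid_step (A @ u @ B) (A @ v @ B)"
  proof cases
    case (1 x y A' a b B')
    then show ?thesis
      using braid_step.intros[of x y "A @ A'" a b "B' @ B"] by simp
  qed
qed

lemma braid_equiv_append: "u \<approx> u' \<Longrightarrow> v \<approx> v' \<Longrightarrow> u @ v \<approx> u' @ v'"
  using braid_equiv_context[of u u' "[]" v] braid_equiv_context[of v v' u' "[]"]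
  by (auto intro: equivclp_trans)

text \<open>Moves depend on the labels alone, never on the names. Hence realised renamings can be
  composed, and can be carried over from one sequence to an equivalent one.\<close>

lemma braid_equiv_relabel: "u \<approx> v \<Longrightarrow> map (apsnd f) u \<approx> map (apsnd f) v"
proof (erule equivclp_map)
  fix u v :: "('a \<times> 'b) list"
  assume "braid_step u v"
  then show "braid_step (map (apsnd f) u) (map (apsnd f) v)"
    by cases (auto intro: braid_step.intros)
qed

lemma braid_equiv_distinct: "u \<approx> v \<Longrightarrow> distinct (map snd u) \<longleftrightarrow> distinct (map snd v)"
  by (erule equivclp_invariant) (auto elim!: braid_step.cases)

text \<open>A move replaces a label x by some x^y in the same component, so the set of pairs
  (component of the label, name) is invariant.\<close>

lemma braid_equiv_component:
  fixes u v :: "('a \<times> 'b) list"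
  assumes "u \<approx> v" "(x, i) \<in> set u" "x \<in> X"
  obtains y where "(y, i) \<in> set v" "(x, y) \<in> rack_conn X op"
proof -
  define f :: "'a \<times> 'b \<Rightarrow> _" where "f = apfst (\<lambda>x. rack_conn X op `` {x})"
  have f: "f (x, a) = (rack_conn X op `` {x}, a)" for x a
    by (simp add: f_def)
  have "f ` set u = f ` set v"
    using assms(1)
  proof (rule equivclp_invariant)
    fix u v :: "('a \<times> 'b) list"
    assume "braid_step u v"
    then show "f ` set u = f ` set v"
    proof cases
      case (1 x y A a b B)
      have "f (op x y, a) = f (x, a)"
        unfolding f by (simp only: equiv_class_eq[OF equiv_rack_conn rack_conn_op[OF 1(3,4)]])
      then show ?thesis
        unfolding 1(1,2) by (simp add: insert_commute)
    qed
  qed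
  with assms(2) have "f (x, i) \<in> f ` set v"
    by blast
  then obtain y where "(y, i) \<in> set v" "rack_conn X op `` {x} = rack_conn X op `` {y}"
    by (auto simp: f)
  moreover have "x \<in> rack_conn X op `` {x}"
    using equiv_class_self[OF equiv_rack_conn assms(3)] .
  ultimately show ?thesis
    using that[of y] equiv_rack_conn by (auto simp: equiv_def sym_def)
qed

text \<open>Translation by y maps the finite set Y injectively into itself, hence onto itself. A
  closed subset is therefore also closed under inverse translations, and injectivity on X excludes
  preimages outside Y.\<close>

lemma op_in_closed_iff:
  assumes "Y \<subseteq> X" "\<forall>a\<in>Y. \<forall>b\<in>Y. op a b \<in> Y" "x \<in> X" "y \<in> Y"
  shows "op x y \<in> Y \<longleftrightarrow> x \<in> Y"
proof -
  have inj: "inj_on (\<lambda>x. op x y) X"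
    using bij_op assms by (auto simp: bij_betw_def)
  have "(\<lambda>x. op x y) ` Y = Y"
  proof (rule endo_inj_surj)
    show "finite Y"
      using assms(1) finite by (rule finite_subset)
    show "(\<lambda>x. op x y) ` Y \<subseteq> Y"
      using assms(2,4) by (intro image_subsetI) simp
    show "inj_on (\<lambda>x. op x y) Y"
      using inj assms(1) by (rule inj_on_subset)
  qed
  then show ?thesis
    using inj_on_image_mem_iff[OF inj assms(3,1)] by simp
qed

text \<open>Taken with Y = X this keeps labels inside the rack; taken with all closed Y it shows
  that generating X is invariant under braid moves.\<close>

lemma braid_equiv_subrack:
  assumes "u \<approx> v" "Y \<subseteq> X" "\<forall>a\<in>Y. \<forall>b\<in>Y. op a b \<in> Y"
  shows "fst ` set u \<subseteq> Y \<longleftrightarrow> fst ` set v \<subseteq> Y"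
  using assms(1)
proof (rule equivclp_invariant)
  fix u v :: "('a \<times> 'b) list"
  assume "braid_step u v"
  then show "fst ` set u \<subseteq> Y \<longleftrightarrow> fst ` set v \<subseteq> Y"
  proof cases
    case (1 x y A a b B)
    have "y \<in> Y \<Longrightarrow> op x y \<in> Y \<longleftrightarrow> x \<in> Y"
      using op_in_closed_iff[OF assms(2,3)] 1 by blast
    with 1 show ?thesis by auto
  qed
qed

lemma braid_equiv_labels: "u \<approx> v \<Longrightarrow> fst ` set u \<subseteq> X \<longleftrightarrow> fst ` set v \<subseteq> X"
  by (rule braid_equiv_subrack) auto

lemma braid_equiv_generates:
  assumes "u \<approx> v" "rack_generates X op (map fst u)"
  shows "rack_generates X op (map fst v)"
  using assms braid_equiv_subrack[OF assms(1)] unfolding rack_generates_def by simp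

section \<open>Moving a strand past others, and rotating three equal labels\<close>

lemma braid_equiv_move_left:
  "fst ` set V \<subseteq> X \<Longrightarrow> x \<in> X \<Longrightarrow> V @ [(x, a)] \<approx> (x, a) # map (apfst (\<lambda>y. op y x)) V"
proof (induction V)
  case (Cons q V)
  obtain y b where q: "q = (y, b)" by fastforce
  have "(q # V) @ [(x, a)] \<approx> q # (x, a) # map (apfst (\<lambda>y. op y x)) V"
    using braid_equiv_append[of "[q]" "[q]"] Cons by simp
  also have "\<dots> \<approx> (x, a) # map (apfst (\<lambda>y. op y x)) (q # V)"
    using braid_equiv_swap[of y x "[]"] Cons.prems by (simp add: q)
  finally show ?case .
qed simp

lemma braid_equiv_move_right:
  "fst ` set V \<subseteq> X \<Longrightarrow> y \<in> X \<Longrightarrow> (y, b) # V \<approx> V @ [(foldl op y (map fst V), b)]"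
proof (induction V arbitrary: y)
  case (Cons q V)
  obtain x a where q: "q = (x, a)" by fastforce
  have "(y, b) # q # V \<approx> [q] @ (op y x, b) # V"
    using braid_equiv_swap[of y x "[]"] Cons.prems by (simp add: q)
  also have "\<dots> \<approx> [q] @ V @ [(foldl op (op y x) (map fst V), b)]"
    by (intro braid_equiv_append Cons.IH) (use Cons.prems q in auto)
  finally show ?case by (simp add: q)
qed simp

text \<open>Both sides reduce to a common sequence by positive crossings only, which avoids the
  inverse operation; note that x, op x x and op (op x x) x all act in the same way.\<close>

lemma braid_equiv_rotate_equal:
  assumes x: "x \<in> X"
  shows "[(x, a), (x, b), (x, c)] \<approx> [(x, b), (x, c), (x, a)]"
proof -
  define t where "t = op x x"
  define t2 where "t2 = op t x"
  have X: "t \<in> X" "t2 \<in> X"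
    using x by (auto simp: t_def t2_def)
  have t: "op w t = op w x" "op w t2 = op w x" if "w \<in> X" for w
  proof -
    show "op w t = op w x"
      using that x by (simp add: t_def op_op_self)
    have "op t t = t2"
      using x by (simp add: t_def t2_def op_op_self)
    then show "op w t2 = op w x"
      using that X(1) \<open>op w t = op w x\<close> op_op_self[of w t] by simp
  qed
  have tt: "op x x = t" "op x t = t" "op x t2 = t" "op t x = t2" "op t t = t2" "op t t2 = t2"
    using t[OF x] t[OF X(1)] by (auto simp: t_def t2_def)
  note s1 = braid_equiv_swap[of _ _ "[]" _ _ "[_]", simplified]
  note s2 = braid_equiv_swap[of _ _ "[_]" _ _ "[]", simplified]
  have "[(x, a), (x, b), (x, c)] \<approx> [(x, b), (t, a), (x, c)]"
    using s1[of x x] x by (simp add: tt)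
  also have "\<dots> \<approx> [(x, b), (x, c), (t2, a)]"
    using s2[of t x] x X by (simp add: tt)
  also have "\<dots> \<approx> [(x, c), (t, b), (t2, a)]"
    using s1[of x x] x by (simp add: tt)
  also have "\<dots> \<approx> [(t, b), (t, c), (t2, a)]"
    using s1[of x t] x X by (simp add: tt)
  also have "\<dots> \<approx> [(t, c), (t2, b), (t2, a)]"
    using s1[of t t] X by (simp add: tt)
  finally have 1: "[(x, a), (x, b), (x, c)] \<approx> [(t, c), (t2, b), (t2, a)]" .
  have "[(x, b), (x, c), (x, a)] \<approx> [(x, b), (x, a), (t, c)]"
    using s2[of x x] x by (simp add: tt)
  also have "\<dots> \<approx> [(x, b), (t, c), (t, a)]"
    using s2[of x t] x X by (simp add: tt)
  also have "\<dots> \<approx> [(t, c), (t, b), (t, a)]"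
    using s1[of x t] x X by (simp add: tt)
  also have "\<dots> \<approx> [(t, c), (t, a), (t2, b)]"
    using s2[of t t] X by (simp add: tt)
  also have "\<dots> \<approx> [(t, c), (t2, b), (t2, a)]"
    using s2[of t t2] X by (simp add: tt)
  finally show ?thesis
    using 1 by (blast intro: equivclp_trans equivclp_sym)
qed

section \<open>Blocks of equally labelled strands\<close>

lemma foldl_op_replicate: "foldl op y (replicate n x) = ((\<lambda>v. op v x) ^^ n) y"
proof (induction n arbitrary: y)
  case (Suc n)
  then show ?case
    using funpow_swap1[of "\<lambda>v. op v x" n y] by simp
qed simp

definition rack_period :: "nat \<Rightarrow> bool" where
  "rack_period e \<longleftrightarrow> (\<forall>x\<in>X. \<forall>y\<in>X. ((\<lambda>v. op v x) ^^ e) y = y)"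

text \<open>A strand labelled y that moves right through the block is acted on by x once per block
  strand. The length of the block is a period, so y is restored, while the block strands keep their
  labels throughout.\<close>

lemma block_commute:
  assumes "rack_period (length bs)" "x \<in> X" "fst ` set U \<subseteq> X"
  shows "map (Pair x) bs @ U \<approx> U @ map (Pair x) bs"
  using assms(3)
proof (induction U)
  case (Cons q U)
  obtain y c where q: "q = (y, c)" by fastforce
  have "map fst (map (Pair x) bs) = replicate (length bs) x"
    by (simp add: comp_def map_replicate_const)
  moreover have "((\<lambda>v. op v x) ^^ length bs) y = y"
    using assms(1,2) Cons.prems q by (simp add: rack_period_def)
  ultimately have "[q] @ map (Pair x) bs \<approx> map (Pair x) bs @ [q]"
    using braid_equiv_move_right[of "map (Pair x) bs" y c] assms(2) Cons.prems
    by (simp add: q foldl_op_replicate image_subset_iff)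
  from braid_equiv_append[OF equivclp_sym[OF this] equivclp_refl[of _ U]]
  have "map (Pair x) bs @ q # U \<approx> [q] @ map (Pair x) bs @ U"
    by simp
  also have "\<dots> \<approx> [q] @ U @ map (Pair x) bs"
    using Cons by (intro braid_equiv_append[of "[q]" "[q]"]) auto
  finally show ?case by simp
qed simp

text \<open>The block is brought next to a strand labelled z. That strand crosses to the left of the
  block, which turns x into x^z; the block then returns to its place by commuting, which changes no
  label. The net effect is a loop of the block around z.\<close>

lemma block_op:
  assumes "rack_period (length bs)" "x \<in> X" "fst ` set U \<subseteq> X" "z \<in> fst ` set U"
  shows "map (Pair x) bs @ U \<approx> map (Pair (op x z)) bs @ U"
proof -
  let ?B = "\<lambda>v. map (Pair v) bs"
  obtain c where "(z, c) \<in> set U"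
    using assms(4) by auto
  then obtain U1 U2 where U: "U = U1 @ (z, c) # U2"
    by (meson split_list)
  have z: "z \<in> X" and U1: "fst ` set U1 \<subseteq> X"
    using assms(3) by (auto simp: U)
  have "?B x @ U \<approx> U1 @ ?B x @ (z, c) # U2"
    using braid_equiv_context[OF block_commute[OF assms(1,2) U1], of "[]" "(z, c) # U2"]
    by (simp add: U)
  also have "\<dots> \<approx> U1 @ (z, c) # ?B (op x z) @ U2"
  proof -
    have "?B x @ [(z, c)] \<approx> (z, c) # map (apfst (\<lambda>y. op y z)) (?B x)"
      using assms(2) z by (intro braid_equiv_move_left) auto
    from braid_equiv_context[OF this, of U1 U2] show ?thesis
      by (simp add: comp_def)
  qed
  also have "\<dots> \<approx> U1 @ ?B (op x z) @ (z, c) # U2"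
  proof -
    have "?B (op x z) @ [(z, c)] \<approx> [(z, c)] @ ?B (op x z)"
      using assms(1,2) z by (intro block_commute) auto
    from braid_equiv_context[OF equivclp_sym[OF this], of U1 U2] show ?thesis
      by simp
  qed
  also have "\<dots> \<approx> ?B (op x z) @ U"
  proof -
    have "?B (op x z) @ U1 \<approx> U1 @ ?B (op x z)"
      using assms(1,2) z U1 by (intro block_commute) auto
    from braid_equiv_context[OF equivclp_sym[OF this], of "[]" "(z, c) # U2"] show ?thesis
      by (simp add: U)
  qed
  finally show ?thesis .
qed

text \<open>The elements z whose action can be applied to every block form a subset of X that
  contains the labels of U. It is closed under the operation because acting by z^w amounts to
  undoing w, acting by z and acting by w. As the labels of U generate X, it is all of X.\<close>

lemma block_component:
  assumes "rack_period (length bs)" "fst ` set U \<subseteq> X" "rack_generates X op (map fst U)"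
    and "(x, y) \<in> rack_conn X op"
  shows "map (Pair x) bs @ U \<approx> map (Pair y) bs @ U"
proof -
  let ?B = "\<lambda>v. map (Pair v) bs @ U"
  let ?Y = "{z \<in> X. \<forall>v\<in>X. ?B v \<approx> ?B (op v z)}"
  have "?Y = X"
  proof (rule assms(3)[unfolded rack_generates_def, rule_format], intro conjI ballI)
    show "set (map fst U) \<subseteq> ?Y"
      using block_op[OF assms(1) _ assms(2)] assms(2) by auto
  next
    fix z w assume z: "z \<in> ?Y" and w: "w \<in> ?Y"
    have "?B v \<approx> ?B (op v (op z w))" if v: "v \<in> X" for v
    proof -
      \<comment> \<open>Here v' is v with the action of w undone; equivalences can be read
        backwards, so a block of v can become a block of v'.\<close>
      obtain v' where v': "v' \<in> X" "op v' w = v"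
        by (rule op_surj[of v w]) (use v w in auto)
      have "?B v \<approx> ?B v'"
        using w v' by (auto intro: equivclp_sym)
      also have "\<dots> \<approx> ?B (op v' z)"
        using z v' by simp
      also have "\<dots> \<approx> ?B (op (op v' z) w)"
        using z w v' by simp
      also have "op (op v' z) w = op v (op z w)"
        using op_distrib[of z w v'] z w v' by auto
      finally show ?thesis .
    qed
    then show "op z w \<in> ?Y"
      using z w by simp
  qed auto
  then have "?B v \<approx> ?B (op v z)" if "v \<in> X" "z \<in> X" for v z
    using that by auto
  \<comment> \<open>Being reachable from the block of x is constant along a component, and the block
    of x reaches itself.\<close>
  then have "?B x \<approx> ?B x \<longleftrightarrow> ?B x \<approx> ?B y"
    by (intro rack_conn_invariant[OF assms(4)]) (meson equivclp_sym equivclp_trans)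
  then show ?thesis by simp
qed

section \<open>Realising 3-cycles of strand names\<close>

lemma gather_block:
  assumes "fst ` set u \<subseteq> X" "x \<in> X" "m + r \<le> count_list (map fst u) x"
  obtains bs U where "length bs = m" "u \<approx> map (Pair x) bs @ U" "r \<le> count_list (map fst U) x"
  using assms(3)
proof (induction m arbitrary: r thesis)
  case 0
  show ?case
    using 0(1)[of "[]" u] 0(2) by simp
next
  case (Suc m)
  from Suc.prems(2) have "m + Suc r \<le> count_list (map fst u) x"
    by simp
  then obtain bs U where bs: "length bs = m" "u \<approx> map (Pair x) bs @ U"
    and U: "Suc r \<le> count_list (map fst U) x"
    using Suc.IH by blast
  from U have "x \<in> set (map fst U)"
    using count_notin by fastforce
  then obtain a where "(x, a) \<in> set U"
    by auto
  then have "\<exists>q\<in>set U. fst q = x"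
    by force
  \<comment> \<open>The first occurrence of x is chosen: the strands in A that it passes get new
    labels, but none of them carried x, so no further copy of x is lost.\<close>
  then obtain A q B where "U = A @ q # B" "fst q = x" and A: "\<forall>p\<in>set A. fst p \<noteq> x"
    by (rule split_list_first_propE)
  then obtain a where split: "U = A @ (x, a) # B"
    by (metis prod.collapse)
  have UX: "fst ` set U \<subseteq> X"
    using braid_equiv_labels[OF bs(2)] assms(1) by (simp add: image_Un)
  let ?A = "map (apfst (\<lambda>y. op y x)) A"
  have "A @ [(x, a)] \<approx> (x, a) # ?A"
    using UX split by (intro braid_equiv_move_left) auto
  from braid_equiv_context[OF this, of "map (Pair x) bs" B]
  have "u \<approx> map (Pair x) (bs @ [a]) @ ?A @ B"
    using bs(2) by (auto simp: split intro: equivclp_trans)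
  moreover have "count_list (map fst A) x = 0"
    using A by (intro count_notin) auto
  then have "r \<le> count_list (map fst (?A @ B)) x"
    using U by (simp add: split)
  ultimately show ?case
    using Suc.prems(1)[of "bs @ [a]"] bs(1) by simp
qed

text \<open>Strand i is moved next to b and c, where the rotation of three equal labels renames b to
  c, c to i and i to b. Undoing the move on the renamed sequence gives the 3-cycle on u
  itself.\<close>

lemma three_equal_labels:
  assumes "distinct (map snd u)" "fst ` set u \<subseteq> X" "u = (y, b) # (y, c) # V" "(y, i) \<in> set V"
  shows "u \<approx> map (apsnd (transpose i b \<circ> transpose b c)) u"
proof -
  define f where "f = transpose i b \<circ> transpose b c"
  obtain V1 V2 where V: "V = V1 @ (y, i) # V2"
    using assms(4) by (meson split_list)
  have y: "y \<in> X"
    using assms(2,3) by simp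
  define W where "W = map (apfst (\<lambda>v. op v y)) V1 @ V2"
  have u: "u \<approx> [(y, b), (y, c), (y, i)] @ W"
  proof -
    have "V1 @ [(y, i)] \<approx> (y, i) # map (apfst (\<lambda>v. op v y)) V1"
      using assms(2,3) V by (intro braid_equiv_move_left) auto
    from braid_equiv_context[OF this, of "[(y, b), (y, c)]" V2] show ?thesis
      by (simp add: assms(3) V W_def)
  qed
  with assms(1) have dist: "distinct (map snd ([(y, b), (y, c), (y, i)] @ W))"
    using braid_equiv_distinct by blast
  \<comment> \<open>The names are distinct and the 3-cycle moves only b, c and i, so the remaining
    strands keep their names.\<close>
  have "map (apsnd f) W = W"
  proof (rule map_idI)
    fix q assume "q \<in> set W"
    then have "snd q \<notin> {b, c, i}"
      using dist by force
    then have "f (snd q) = snd q"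
      by (simp add: f_def transpose_def)
    then show "apsnd f q = q"
      by (simp add: apsnd_def map_prod_def split_beta)
  qed
  moreover have "f b = c" "f c = i" "f i = b"
    using dist by (auto simp: f_def transpose_def)
  ultimately have "map (apsnd f) ([(y, b), (y, c), (y, i)] @ W) = [(y, c), (y, i), (y, b)] @ W"
    by simp
  moreover have "[(y, b), (y, c), (y, i)] @ W \<approx> [(y, c), (y, i), (y, b)] @ W"
    by (intro braid_equiv_append braid_equiv_rotate_equal y equivclp_refl)
  ultimately have "u \<approx> map (apsnd f) ([(y, b), (y, c), (y, i)] @ W)"
    using u by (auto intro: equivclp_trans)
  also have "\<dots> \<approx> map (apsnd f) u"
    by (intro braid_equiv_relabel equivclp_sym[OF u])
  finally show ?thesis
    by (simp add: f_def)
qed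

lemma three_cycles:
  assumes "rack_period e" "2 \<le> e" "distinct (map snd u)" "fst ` set u \<subseteq> X"
    and gen: "rack_generates X op (map fst u)"
    and "x \<in> X" and count: "e < count_list (map fst u) x"
  obtains b c where "b \<noteq> c"
    and "\<And>y i. (y, i) \<in> set u \<Longrightarrow> (x, y) \<in> rack_conn X op \<Longrightarrow> i \<notin> {b, c} \<Longrightarrow>
           u \<approx> map (apsnd (transpose i b \<circ> transpose b c)) u"
proof -
  \<comment> \<open>One copy of x stays outside the block. The labels of U are then all the labels
    present, so U generates X by itself and can steer the block.\<close>
  obtain bs U where bs: "length bs = e" and u: "u \<approx> map (Pair x) bs @ U"
    and "1 \<le> count_list (map fst U) x"
    using gather_block[OF assms(4,6), of e 1] count by auto
  then have xU: "x \<in> fst ` set U"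
    using count_notin[of x "map fst U"] by fastforce
  obtain b c bs' where bs': "bs = b # c # bs'"
    using bs assms(2) by (cases bs; cases "tl bs") auto
  have dist: "distinct (map snd (map (Pair x) bs @ U))"
    using braid_equiv_distinct[OF u] assms(3) by simp
  have labels: "fst ` set (map (Pair x) bs @ U) \<subseteq> X"
    using braid_equiv_labels[OF u] assms(4) by simp
  then have UX: "fst ` set U \<subseteq> X"
    by (simp add: image_Un)
  have "set (map fst (map (Pair x) bs @ U)) = set (map fst U)"
    using xU by auto
  then have genU: "rack_generates X op (map fst U)"
    using braid_equiv_generates[OF u gen] unfolding rack_generates_def by simp
  have "u \<approx> map (apsnd (transpose i b \<circ> transpose b c)) u"
    if i: "(y, i) \<in> set u" "(x, y) \<in> rack_conn X op" "i \<notin> {b, c}" for y i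
  proof -
    \<comment> \<open>Gathering the block may have changed the label of strand i, but not its
      component, so the block can still be given the new label z.\<close>
    obtain z where z: "(z, i) \<in> set (map (Pair x) bs @ U)" "(y, z) \<in> rack_conn X op"
      using braid_equiv_component[OF u i(1)] i(1) assms(4) by force
    have xz: "(x, z) \<in> rack_conn X op"
      using i(2) z(2) equiv_rack_conn by (meson equivE transE)
    obtain V where V: "u \<approx> (z, b) # (z, c) # V" "(z, i) \<in> set V"
    proof (cases "(z, i) \<in> set U")
      case True
      have "u \<approx> map (Pair z) bs @ U"
        using equivclp_trans[OF u block_component[OF _ UX genU xz]] assms(1) bs by simp
      with True show ?thesis
        using that[of "map (Pair z) bs' @ U"] by (simp add: bs')
    next
      \<comment> \<open>Now i lies in the block itself, so z is x and b, c, i already share a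
        label.\<close>
      case False
      then show ?thesis
        using that[of "map (Pair x) bs' @ U"] z(1) u i(3) by (auto simp: bs')
    qed
    let ?f = "transpose i b \<circ> transpose b c"
    have "(z, b) # (z, c) # V \<approx> map (apsnd ?f) ((z, b) # (z, c) # V)"
      using braid_equiv_distinct[OF V(1)] braid_equiv_labels[OF V(1)] assms(3,4) V(2)
      by (intro three_equal_labels[OF _ _ refl]) auto
    with V(1) have "u \<approx> map (apsnd ?f) ((z, b) # (z, c) # V)"
      by (rule equivclp_trans)
    also have "\<dots> \<approx> map (apsnd ?f) u"
      by (intro braid_equiv_relabel equivclp_sym[OF V(1)])
    finally show ?thesis .
  qed
  moreover have "b \<noteq> c"
    using dist by (simp add: bs')
  ultimately show ?thesis
    using that by blast
qed

section \<open>From equivalences of named strands to braid words\<close>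

text \<open>The equivalence closure uses moves in both directions: forwards a move is the generator,
  backwards its inverse. Inverse translations enter the argument only here.\<close>

lemma braid_step_word:
  assumes "braid_step u v"
  obtains i where "Suc i < length u" "length v = length u"
    and "map fst v = braid_letter_act X op (map fst u) (i, True)"
    and "map fst u = braid_letter_act X op (map fst v) (i, False)"
    and "map snd v = map (\<lambda>j. map snd u ! transpose i (Suc i) j) [0..<length u]"
    and "map snd u = map (\<lambda>j. map snd v ! transpose i (Suc i) j) [0..<length v]"
  using assms
proof cases
  case (1 x y A a b B)
  have swap: "C @ p # q # D = map (\<lambda>j. (C @ q # p # D) ! transpose (length C) (Suc (length C)) j) [0..<n]"
    if n: "n = length C + Suc (Suc (length D))" for C D n and p q :: 'b
  proof (rule nth_equalityI)
    fix j assume "j < length (C @ p # q # D)"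
    then have j: "j < n"
      by (simp add: n)
    consider "j < length C" | "j = length C" | "j = Suc (length C)"
      | "Suc (length C) < j"
      by linarith
    then have "(C @ p # q # D) ! j = (C @ q # p # D) ! transpose (length C) (Suc (length C)) j"
    proof cases
      case 4
      from less_imp_Suc_add[OF 4] obtain k where "j = Suc (Suc (length C) + k)" ..
      then show ?thesis
        by (simp add: nth_append)
    qed (simp_all add: nth_append)
    with j show "(C @ p # q # D) ! j =
        map (\<lambda>j. (C @ q # p # D) ! transpose (length C) (Suc (length C)) j) [0..<n] ! j"
      by simp
  qed (simp add: n)
  have "the_inv_into X (\<lambda>v. op v y) (op x y) = x"
    using bij_op[OF 1(4)] 1(3) by (intro the_inv_into_f_eq) (auto simp: bij_betw_def)
  show ?thesis
  proof (rule that[of "length A"])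
    show "map fst v = braid_letter_act X op (map fst u) (length A, True)"
      by (simp add: 1(1,2) braid_letter_act_def nth_append list_update_append)
    show "map fst u = braid_letter_act X op (map fst v) (length A, False)"
      using \<open>the_inv_into X (\<lambda>v. op v y) (op x y) = x\<close>
      by (simp add: 1(1,2) braid_letter_act_def nth_append list_update_append)
    have snd: "map snd u = map snd A @ a # b # map snd B" "map snd v = map snd A @ b # a # map snd B"
      by (simp_all add: 1(1,2))
    show "map snd v = map (\<lambda>j. map snd u ! transpose (length A) (Suc (length A)) j) [0..<length u]"
      unfolding snd length_map[of snd A, symmetric] by (rule swap) (simp add: 1(1))
    show "map snd u = map (\<lambda>j. map snd v ! transpose (length A) (Suc (length A)) j) [0..<length v]"
      unfolding snd length_map[of snd A, symmetric] by (rule swap) (simp add: 1(2))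
  qed (simp_all add: 1(1,2))
qed

text \<open>Each move appends one letter. The new names are the old ones read through a
  transposition of positions, which composes on the right, just as in
  \<open>braid_perm\<close>.\<close>

lemma braid_equiv_word:
  assumes "u \<approx> v"
  shows "\<exists>w. braid_word (length u) w \<and> length v = length u \<and>
    map fst v = braid_act X op (map fst u) w \<and>
    map snd v = map (\<lambda>j. map snd u ! braid_perm w j) [0..<length u]"
  using assms
proof induction
  case base
  show ?case
    using map_nth[of "map snd u"]
    by (intro exI[of _ "[]"]) (simp add: braid_word_def braid_act_def braid_perm_def)
next
  case (step y z)
  obtain w where w: "braid_word (length u) w" "length y = length u"
    "map fst y = braid_act X op (map fst u) w"
    "map snd y = map (\<lambda>j. map snd u ! braid_perm w j) [0..<length u]"
    using step.IH by (elim exE conjE) (rule that)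
  obtain i e where l: "Suc i < length y" "length z = length y"
    "map fst z = braid_letter_act X op (map fst y) (i, e)"
    "map snd z = map (\<lambda>j. map snd y ! transpose i (Suc i) j) [0..<length y]"
    using step.hyps(2)
  proof
    assume "braid_step y z"
    then show ?thesis
      by (rule braid_step_word) (rule that)
  next
    assume "braid_step z y"
    then obtain i where i: "Suc i < length z" "length y = length z"
      "map fst z = braid_letter_act X op (map fst y) (i, False)"
      "map snd z = map (\<lambda>j. map snd y ! transpose i (Suc i) j) [0..<length y]"
      by (rule braid_step_word)
    show ?thesis
    proof (rule that)
      show "Suc i < length y" "length z = length y"
        using i(1,2) by auto
    qed (fact i)+
  qed
  have "transpose i (Suc i) j < length u" if "j < length u" for j
    using that l(1) w(2) by (auto simp: transpose_def)
  then have "map snd z = map (\<lambda>j. map snd u ! braid_perm (w @ [(i, e)]) j) [0..<length u]"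
    unfolding l(4) w(2) unfolding w(4) by (simp add: braid_perm_def)
  then show ?case
    using w(1-3) l(1-3)
    by (intro exI[of _ "w @ [(i, e)]"]) (auto simp: braid_word_def braid_act_def)
qed

end

lemma braid_perm_permutes: "braid_word n w \<Longrightarrow> braid_perm w permutes {..<n}"
proof (induction w rule: rev_induct)
  case Nil
  show ?case
    using permutes_id[of "{..<n}"] by (simp add: braid_perm_def id_def)
next
  case (snoc l w)
  then show ?case
    by (auto simp: braid_perm_def braid_word_def intro!: permutes_compose permutes_swap_id)
qed

section \<open>Generating alternating groups, and the pigeonhole argument\<close>

text \<open>The set G stands for the odd coset of H, represented by t = (b c). It contains every
  transposition of two points of D, and parity then decides whether p or t p lies in H. As H is
  given only as a monoid, G asks for both products with t.\<close>

lemma evenperm_from_three_cycles: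
  assumes "id \<in> H" and comp: "\<And>f g. f \<in> H \<Longrightarrow> g \<in> H \<Longrightarrow> f \<circ> g \<in> H"
    and "b \<noteq> c"
    and cycles: "\<And>i. i \<in> D \<Longrightarrow> i \<notin> {b, c} \<Longrightarrow> transpose i b \<circ> transpose b c \<in> H"
    and "p permutes D" "finite D" "evenperm p"
  shows "p \<in> H"
proof -
  let ?t = "transpose b c"
  define G where "G = {f. f \<circ> ?t \<in> H \<and> ?t \<circ> f \<in> H}"
  \<comment> \<open>Insert t t = id between neighbouring factors.\<close>
  have conj: "f \<circ> g \<circ> f \<in> G" if "f \<in> G" "g \<in> G" for f g
  proof -
    have "f \<circ> g \<circ> f \<circ> ?t = (f \<circ> ?t) \<circ> ((?t \<circ> g) \<circ> (f \<circ> ?t))"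
      "?t \<circ> (f \<circ> g \<circ> f) = (?t \<circ> f) \<circ> ((g \<circ> ?t) \<circ> (?t \<circ> f))"
      by (simp_all add: fun_eq_iff)
    with that show ?thesis
      unfolding G_def by (metis (mono_tags, lifting) comp mem_Collect_eq)
  qed
  have "?t \<in> G"
    using assms(1) by (simp add: G_def)
  have b: "transpose i b \<in> G" if "i \<in> D" "i \<notin> {b, c}" for i
  proof -
    \<comment> \<open>The inverse of a 3-cycle is its square, which supplies the second product from
      the first.\<close>
    have "?t \<circ> transpose i b = (transpose i b \<circ> ?t) \<circ> (transpose i b \<circ> ?t)"
      using that \<open>b \<noteq> c\<close> by (auto simp: fun_eq_iff transpose_def)
    then show ?thesis
      using cycles[OF that] comp by (simp add: G_def)
  qed
  have c: "transpose i c \<in> G" if "i \<in> D" "i \<notin> {b, c}" for i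
  proof -
    have "transpose i c = ?t \<circ> transpose i b \<circ> ?t"
      using that \<open>b \<noteq> c\<close> by (auto simp: fun_eq_iff transpose_def)
    then show ?thesis
      using conj[OF \<open>?t \<in> G\<close> b[OF that]] by simp
  qed
  have bc: "transpose k l \<in> G" "transpose l k \<in> G" if "k \<in> {b, c}" "l \<in> D" "k \<noteq> l" for k l
  proof -
    have "transpose l k \<in> G"
    proof (cases "l \<in> {b, c}")
      case True
      then show ?thesis
        using that \<open>?t \<in> G\<close> transpose_commute[of b c] by auto
    next
      case False
      then show ?thesis
        using that b c by auto
    qed
    then show "transpose k l \<in> G" "transpose l k \<in> G"
      using transpose_commute[of k l] by simp_all
  qed
  have swap: "transpose i j \<in> G" if "i \<in> D" "j \<in> D" "i \<noteq> j" for i j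
  proof (cases "i \<in> {b, c} \<or> j \<in> {b, c}")
    case True
    then show ?thesis
      using that bc by blast
  next
    case False
    then have "transpose i j = transpose i b \<circ> transpose j b \<circ> transpose i b"
      using that by (auto simp: fun_eq_iff transpose_def)
    then show ?thesis
      using conj[OF b[of i] b[of j]] that False by simp
  qed
  \<comment> \<open>Odd permutations are included because the induction multiplies by one
    transposition at a time and so alternates parity.\<close>
  have "(evenperm p \<longrightarrow> p \<in> H) \<and> (\<not> evenperm p \<longrightarrow> ?t \<circ> p \<in> H)"
    using assms(5,6)
  proof (induction rule: permutes_induct)
    case id
    then show ?case
      using assms(1) by (simp add: id_def)
  next
    case (swap i j p)
    have "permutation p"
      using swap.hyps \<open>finite D\<close> permutation_permutes by blast
    then have even: "evenperm (transpose i j \<circ> p) \<longleftrightarrow> \<not> evenperm p"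
      using \<open>i \<noteq> j\<close> by (simp add: evenperm_comp permutation_swap_id evenperm_swap)
    have eqs: "transpose i j \<circ> p = (transpose i j \<circ> ?t) \<circ> (?t \<circ> p)"
      "?t \<circ> (transpose i j \<circ> p) = (?t \<circ> transpose i j) \<circ> p"
      by (simp_all add: fun_eq_iff)
    have "transpose i j \<in> G"
      using swap.hyps by (intro \<open>\<And>i j. i \<in> D \<Longrightarrow> j \<in> D \<Longrightarrow> i \<noteq> j \<Longrightarrow> transpose i j \<in> G\<close>)
    then have G: "transpose i j \<circ> ?t \<in> H" "?t \<circ> transpose i j \<in> H"
      by (simp_all add: G_def)
    have "?t \<circ> p \<in> H \<Longrightarrow> transpose i j \<circ> p \<in> H" "p \<in> H \<Longrightarrow> ?t \<circ> (transpose i j \<circ> p) \<in> H"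
      unfolding eqs(2) by (subst eqs(1), rule comp[OF G(1)], assumption) (rule comp[OF G(2)])
    then show ?case
      using even swap.IH by blast
  qed
  with assms(7) show ?thesis by blast
qed

lemma ex_frequent_label:
  assumes "finite C" "e * card C < card {i. i < length s \<and> s ! i \<in> C}"
  obtains x where "x \<in> C" "e < count_list s x"
proof -
  have "{i. i < length s \<and> s ! i \<in> C} = (\<Union>x\<in>C. {i. i < length s \<and> s ! i = x})"
    by auto
  then have "card {i. i < length s \<and> s ! i \<in> C} \<le> (\<Sum>x\<in>C. card {i. i < length s \<and> s ! i = x})"
    using card_UN_le[OF assms(1)] by simp
  also have "\<dots> = (\<Sum>x\<in>C. count_list s x)"
    by (intro sum.cong refl)
      (simp add: count_list_eq_length_filter length_filter_conv_card eq_commute)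
  finally have "\<not> (\<Sum>x\<in>C. count_list s x) \<le> e * card C"
    using assms(2) by simp
  moreover have "(\<Sum>x\<in>C. count_list s x) \<le> e * card C" if "\<forall>x\<in>C. count_list s x \<le> e"
    using sum_bounded_above[of C "count_list s" e] that by (simp add: mult.commute)
  ultimately show ?thesis
    using that by (meson not_le)
qed

section \<open>Assembling the permutation from its restrictions to the components\<close>

theorem theorem4p32:
  fixes X :: "'a set" and op :: "'a \<Rightarrow> 'a \<Rightarrow> 'a"
  assumes "rack X op" and "finite X"
  shows "\<exists>N::nat. \<forall>(s::'a list).
     set s \<subseteq> X \<and> rack_generates X op s \<and>
     (\<forall>C \<in> rack_components X op. card {i. i < length s \<and> s ! i \<in> C} \<ge> N)
     \<longrightarrow> (\<forall>\<sigma>. \<sigma> permutes {..<length s} \<and>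
            (\<forall>C \<in> rack_components X op.
               \<sigma> ` {i. i < length s \<and> s ! i \<in> C} = {i. i < length s \<and> s ! i \<in> C} \<and>
               evenperm (\<lambda>i. if i < length s \<and> s ! i \<in> C then \<sigma> i else i))
            \<longrightarrow> (\<exists>w. braid_word (length s) w \<and> braid_act X op s w = s \<and> braid_perm w = \<sigma>))"
proof -
  interpret finite_rack X op
    by standard fact+
  obtain e where e: "2 \<le> e" "rack_period e"
    using common_period unfolding rack_period_def by metis
  \<comment> \<open>With more than e |X| strands, a component has a label occurring more than e
    times, enough for a block and one further copy.\<close>
  show ?thesis
  proof (rule exI[of _ "Suc (e * card X)"], intro allI impI, elim conjE)
    fix s :: "'a list" and \<sigma> :: "nat \<Rightarrow> nat"
    define D where "D C = {i. i < length s \<and> s ! i \<in> C}" for C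
    \<comment> \<open>Allowing any set C of labels makes the definition apply to unions of
      components, and finally to X.\<close>
    define \<tau> where "\<tau> C = (\<lambda>i. if i \<in> D C then \<sigma> i else i)" for C
    assume s: "set s \<subseteq> X" "rack_generates X op s"
      and N: "\<forall>C \<in> rack_components X op. Suc (e * card X) \<le> card {i. i < length s \<and> s ! i \<in> C}"
      and \<sigma>: "\<sigma> permutes {..<length s}"
      and "\<forall>C \<in> rack_components X op.
        \<sigma> ` {i. i < length s \<and> s ! i \<in> C} = {i. i < length s \<and> s ! i \<in> C} \<and>
        evenperm (\<lambda>i. if i < length s \<and> s ! i \<in> C then \<sigma> i else i)"
    then have \<sigma>D: "\<sigma> ` D C = D C" "evenperm (\<tau> C)" if "C \<in> rack_components X op" for C
      using that by (simp_all add: D_def \<tau>_def)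
    define u where "u = zip s [0..<length s]"
    have u: "map fst u = s" "map snd u = [0..<length s]"
      by (simp_all add: u_def)
    then have uX: "fst ` set u \<subseteq> X"
      using s(1) by (metis list.set_map)
    define H where "H = {f. u \<approx> map (apsnd f) u}"
    have id: "id \<in> H"
      by (simp add: H_def apsnd_def map_prod.id)
    have comp: "f \<circ> g \<in> H" if "f \<in> H" "g \<in> H" for f g
    proof -
      \<comment> \<open>The equivalence for g is renamed by f and then joined to the one for
        f.\<close>
      have "map (apsnd f) u \<approx> map (apsnd f) (map (apsnd g) u)"
        using that(2) by (simp only: H_def mem_Collect_eq braid_equiv_relabel)
      also have "map (apsnd f) (map (apsnd g) u) = map (apsnd (f \<circ> g)) u"
        by (simp add: apsnd_compose)
      finally show ?thesis
        using that(1) by (auto simp: H_def intro: equivclp_trans)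
    qed
    have \<tau>: "\<tau> C \<in> H" if C: "C \<in> rack_components X op" for C
    proof -
      have CX: "C \<subseteq> X"
        using C by (auto simp: rack_components_def rack_conn_def Let_def elim!: quotientE)
      have "e * card C \<le> e * card X"
        using card_mono[OF finite CX] by (rule mult_le_mono2)
      moreover have "Suc (e * card X) \<le> card (D C)"
        using N C by (simp add: D_def)
      ultimately have "e * card C < card (D C)"
        by linarith
      then obtain x where x: "x \<in> C" "e < count_list s x"
        using ex_frequent_label finite_subset[OF CX finite] unfolding D_def by metis
      obtain b c where bc: "b \<noteq> c" "\<And>y i. (y, i) \<in> set u \<Longrightarrow> (x, y) \<in> rack_conn X op \<Longrightarrow>
          i \<notin> {b, c} \<Longrightarrow> u \<approx> map (apsnd (transpose i b \<circ> transpose b c)) u"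
        using three_cycles[OF e(2,1) _ uX, of x] s(2) x CX unfolding u
        by (metis distinct_upt subsetD)
      have "transpose i b \<circ> transpose b c \<in> H" if "i \<in> D C" "i \<notin> {b, c}" for i
      proof -
        have "(s ! i, i) \<in> set u"
          using that(1) by (auto simp: u_def D_def in_set_zip)
        moreover have "(x, s ! i) \<in> rack_conn X op"
          using that(1) x(1) C quotient_eq_iff[OF equiv_rack_conn, of C C x "s ! i"]
          by (simp add: D_def rack_components_def)
        ultimately show ?thesis
          using bc(2) that(2) by (simp add: H_def)
      qed
      moreover have "\<tau> C permutes D C"
      proof (rule bij_imp_permutes)
        have "inj_on (\<tau> C) (D C)"
          using permutes_inj[OF \<sigma>] by (auto simp: \<tau>_def inj_on_def)
        moreover have "\<tau> C ` D C = D C"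
          using \<sigma>D(1)[OF C] by (simp add: \<tau>_def)
        ultimately show "bij_betw (\<tau> C) (D C) (D C)"
          by (simp add: bij_betw_def)
      qed (simp add: \<tau>_def)
      moreover have "finite (D C)"
        by (simp add: D_def)
      ultimately show ?thesis
        using evenperm_from_three_cycles[of H b c "D C" "\<tau> C"] id comp bc(1) \<sigma>D(2)[OF C] by blast
    qed
    \<comment> \<open>The restrictions are multiplied together one component at a time. Components
      are disjoint and \<sigma> preserves each of their strand sets, so every factor fixes the
      strands of the others.\<close>
    have \<tau>_Union: "\<tau> (\<Union>\<C>) \<in> H" if "finite \<C>" "\<C> \<subseteq> rack_components X op" for \<C>
      using that
    proof (induction \<C>)
      case empty
      have "\<tau> (\<Union>{}) = id"
        by (simp add: \<tau>_def D_def fun_eq_iff)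
      with id show ?case
        by (simp only:)
    next
      case (insert C \<C>)
      have disj: "C \<inter> C' = {}" if "C' \<in> \<C>" for C'
        using that insert quotient_disj[OF equiv_rack_conn, of C C']
        by (auto simp: rack_components_def)
      have "\<sigma> i \<in> D C'" if "i \<in> D C'" "C' \<in> \<C>" for i C'
        using \<sigma>D(1)[of C'] that insert.prems by blast
      then have "\<tau> (\<Union>(insert C \<C>)) = \<tau> C \<circ> \<tau> (\<Union>\<C>)"
        using disj by (fastforce simp: \<tau>_def D_def fun_eq_iff)
      moreover have "\<tau> C \<circ> \<tau> (\<Union>\<C>) \<in> H"
        using insert \<tau>[of C] by (intro comp) blast+
      ultimately show ?case
        by (simp only:)
    qed
    have "finite (rack_components X op)"
      using finite_quotient[OF finite] equiv_rack_conn
      by (simp add: rack_components_def equiv_def)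
    then have "\<tau> X \<in> H"
      using \<tau>_Union[of "rack_components X op"] Union_quotient[OF equiv_rack_conn]
      by (simp add: rack_components_def)
    moreover have "\<tau> X = \<sigma>"
    proof
      fix i
      show "\<tau> X i = \<sigma> i"
        using permutes_not_in[OF \<sigma>, of i] subsetD[OF s(1) nth_mem, of i]
        by (cases "i < length s") (auto simp: \<tau>_def D_def)
    qed
    ultimately have "u \<approx> map (apsnd \<sigma>) u"
      by (simp add: H_def)
    moreover have "map fst (map (apsnd \<sigma>) u) = s"
      by (simp add: comp_def u(1))
    moreover have "map snd (map (apsnd \<sigma>) u) = map \<sigma> [0..<length s]"
      by (simp add: comp_def flip: u(2))
    moreover have "length u = length s"
      by (simp add: u_def)
    \<comment> \<open>Since strands are initially named by their positions, the final list of names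
      is the list of values of the braid permutation.\<close>
    ultimately obtain w where w: "braid_word (length s) w" "braid_act X op s w = s"
      "map \<sigma> [0..<length s] = map (\<lambda>j. [0..<length s] ! braid_perm w j) [0..<length s]"
      using braid_equiv_word[of u "map (apsnd \<sigma>) u"] unfolding u by metis
    have perm: "braid_perm w permutes {..<length s}"
      using w(1) by (rule braid_perm_permutes)
    have "braid_perm w i = \<sigma> i" for i
    proof (cases "i < length s")
      case True
      then have "braid_perm w i < length s"
        using permutes_in_image[OF perm, of i] by simp
      with True w(3) show ?thesis
        by (auto simp: map_eq_conv)
    next
      case False
      then show ?thesis
        using permutes_not_in[OF perm] permutes_not_in[OF \<sigma>] by simp
    qed
    with w show "\<exists>w. braid_word (length s) w \<and> braid_act X op s w = s \<and> braid_perm w = \<sigma>"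
      by blast
  qed
qed

end
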